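(* Let $\ell\ge 1$ be an integer. There exist real numbers $0<a_1<a_2<\dots<a_\ell<\frac12$ for which the unique polynomial $p$ of degree $4\ell+1$ satisfying (i) $p(x)+p(1-x)=1$ for all $x\in\mathbb{R}$, and (ii) $p(0)=p(a_i)=p'(a_i)=0$ for $i=1,\dots,\ell$, also satisfies $p(x)\le 1$ for all $x\in[0,\frac12]$.
   Context: For any real numbers $0<a_1<\dots<a_\ell<\frac12$, there is exactly one real polynomial $p$ of degree $4\ell+1$ satisfying (i) and (ii), where $p'$ denotes the derivative of $p$; this is the polynomial referred to in the claim. *)

theory Defs
  imports Complex_Main "HOL-Computational_Algebra.Polynomial"
begin

text \<open>
  The nodes \<open>a\<^sub>1, \<dots>, a\<^sub>\<ell>\<close> are the values at \<open>1, \<dots>, l\<close> of a function \<open>a\<close>;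
  its values elsewhere are irrelevant.
\<close>

definition nodes :: "nat \<Rightarrow> (nat \<Rightarrow> real) \<Rightarrow> bool" where
  "nodes l a \<longleftrightarrow> 0 < a 1 \<and> strict_mono_on {1..l} a \<and> a l < 1 / 2"

definition node_poly :: "nat \<Rightarrow> (nat \<Rightarrow> real) \<Rightarrow> real poly \<Rightarrow> bool" where
  "node_poly l a p \<longleftrightarrow>
     degree p = 4 * l + 1 \<and>
     (\<forall>x. poly p x + poly p (1 - x) = 1) \<and>
     poly p 0 = 0 \<and>
     (\<forall>i\<in>{1..l}. poly p (a i) = 0 \<and> poly (pderiv p) (a i) = 0)"

end

theory Submission
  imports Defs
begin

text \<open>
  Put \<open>n = 4 * l + 1\<close> and let \<open>T\<close> be the Chebyshev polynomial of degree \<open>n\<close>, so that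
  \<open>T (cos t) = cos (n * t)\<close>.  The nodes are chosen such that the interpolating polynomial becomes
  \<open>p x = (1 - T (1 - 2 * x)) / 2\<close>.

  Since \<open>n\<close> is odd, \<open>T\<close> is odd, which is exactly the symmetry \<open>p x + p (1 - x) = 1\<close>.  Since
  \<open>\<bar>T\<bar> \<le> 1\<close> on \<open>[-1, 1]\<close>, the values of \<open>p\<close> on \<open>[0, 1]\<close> lie in \<open>[0, 1]\<close>; in particular every
  zero of \<open>p\<close> in \<open>(0, 1)\<close> is a minimum, hence a double zero.  The zeros in \<open>[0, 1]\<close> correspond to
  the points \<open>cos t\<close> with \<open>n * t\<close> a multiple of \<open>2 * \<pi>\<close>, that is, they are
  \<open>(1 - cos (2 * \<pi> * i / n)) / 2\<close> for \<open>0 \<le> i \<le> 2 * l\<close>.  Because \<open>l < n / 4 < l + 1\<close>,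
  precisely those with \<open>1 \<le> i \<le> l\<close> lie in \<open>(0, 1 / 2)\<close>: there are as many as nodes are wanted.

  Uniqueness holds for all nodes (\<open>node_poly_unique\<close>): the difference of two solutions is
  antisymmetric about \<open>1 / 2\<close>, so besides the double zeros at the nodes it has double zeros at
  their mirror images and simple ones at \<open>0\<close>, \<open>1 / 2\<close> and \<open>1\<close>.  These are \<open>4 * l + 3\<close> zeros, more
  than its degree permits.
\<close>

section \<open>Uniqueness of the interpolating polynomial\<close>

lemma two_le_order:
  fixes p :: "real poly"
  assumes "p \<noteq> 0" "poly p a = 0" "poly (pderiv p) a = 0"
  shows "2 \<le> order a p"
proof -
  have ord: "order a p \<noteq> 0"
    using assms by (simp add: order_root)
  have "pderiv p \<noteq> 0"
  proof
    assume "pderiv p = 0"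
    then obtain c where "p = [:c:]"
      by (auto simp: pderiv_eq_0_iff elim: degree_eq_zeroE)
    then show False
      using assms(1,2) by simp
  qed
  then have "order a p = Suc (order a (pderiv p))" "order a (pderiv p) \<noteq> 0"
    using ord order_pderiv[of p a] assms(1,3) by (simp_all add: order_root)
  then show ?thesis
    by simp
qed

lemma pderiv_antisymmetric:
  fixes d :: "real poly"
  assumes "\<And>x. poly d (1 - x) = - poly d x"
  shows "poly (pderiv d) (1 - x) = poly (pderiv d) x"
proof -
  have "pcompose d [:1, -1:] = - d"
    using assms by (simp add: poly_eq_poly_eq_iff[symmetric] fun_eq_iff poly_pcompose)
  then have "poly (pderiv (pcompose d [:1, -1:])) x = poly (pderiv (- d)) x"
    by simp
  then show ?thesis
    by (simp add: pderiv_pcompose poly_pcompose pderiv_pCons pderiv_minus)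
qed

text \<open>
  Zeros are counted by their order.  Each point of \<open>A\<close> and each mirror image counts at least
  twice.  Antisymmetry moves the zero at \<open>0\<close> to \<open>1\<close> and forces one at the fixed point \<open>1 / 2\<close>
  of the reflection.
\<close>

lemma antisymmetric_eq_0:
  fixes d :: "real poly"
  assumes antisym: "\<And>x. poly d (1 - x) = - poly d x"
    and d0: "poly d 0 = 0"
    and fin: "finite A" and A: "A \<subseteq> {0<..<1/2}"
    and dbl: "\<And>x. x \<in> A \<Longrightarrow> poly d x = 0 \<and> poly (pderiv d) x = 0"
    and deg: "degree d \<le> 4 * card A + 2"
  shows "d = 0"
proof (rule ccontr)
  assume nz: "d \<noteq> 0"
  define B where "B = (\<lambda>x. 1 - x) ` A"
  define S where "S = {0, 1/2, 1 :: real}"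
  have cardB: "card B = card A"
    unfolding B_def by (rule card_image) (auto simp: inj_on_def)
  have finB: "finite B"
    using fin by (simp add: B_def)
  have "\<forall>x\<in>A. 0 < x \<and> x < 1/2" and "\<forall>x\<in>B. 1/2 < x \<and> x < 1"
    using A by (auto simp: B_def)
  then have AB: "A \<inter> B = {}" and SAB: "S \<inter> (A \<union> B) = {}"
    unfolding S_def by fastforce+
  have ordAB: "2 \<le> order x d" if "x \<in> A \<union> B" for x
    using that dbl antisym pderiv_antisymmetric[OF antisym]
    by (intro two_le_order[OF nz]) (auto simp: B_def)
  have "poly d 1 = 0" "poly d (1/2) = 0"
    using d0 antisym[of 0] antisym[of "1/2"] by simp_all
  then have rootS: "poly d x = 0" if "x \<in> S" for x
    using that d0 unfolding S_def by blast
  then have ordS: "1 \<le> order x d" if "x \<in> S" for x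
    using that nz order_root[of d x] by (simp add: Suc_le_eq)
  have "4 * card A + 3 = (\<Sum>x\<in>S. 1) + (\<Sum>x\<in>A \<union> B. 2)"
    using fin finB AB cardB by (simp add: card_Un_disjoint S_def)
  also have "\<dots> \<le> (\<Sum>x\<in>S. order x d) + (\<Sum>x\<in>A \<union> B. order x d)"
    using ordS ordAB by (intro add_mono sum_mono) auto
  also have "\<dots> = (\<Sum>x\<in>S \<union> (A \<union> B). order x d)"
    using fin finB SAB by (intro sum.union_disjoint[symmetric]) (auto simp: S_def)
  also have "\<dots> \<le> (\<Sum>x | poly d x = 0. order x d)"
  proof (rule sum_mono2)
    show "S \<union> (A \<union> B) \<subseteq> {x. poly d x = 0}"
      using rootS dbl antisym by (auto simp: B_def)
  qed (use nz poly_roots_finite in auto)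
  also have "\<dots> \<le> degree d"
    by (rule sum_order_le_degree[OF nz])
  finally show False
    using deg by simp
qed

lemma nodes_subset:
  assumes "nodes l a"
  shows "a ` {1..l} \<subseteq> {0<..<1/2}"
proof
  fix x assume "x \<in> a ` {1..l}"
  then obtain i where i: "1 \<le> i" "i \<le> l" "x = a i"
    by auto
  have "mono_on {1..l} a"
    using assms strict_mono_on_imp_mono_on by (auto simp: nodes_def)
  then have "a 1 \<le> a i" "a i \<le> a l"
    using i mono_onD[of "{1..l}" a 1 i] mono_onD[of "{1..l}" a i l] by simp_all
  then show "x \<in> {0<..<1/2}"
    using assms i by (auto simp: nodes_def)
qed

lemma node_poly_unique:
  assumes a: "nodes l a" and p: "node_poly l a p" and q: "node_poly l a q"
  shows "p = q"
proof -
  have "p - q = 0"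
  proof (rule antisymmetric_eq_0)
    fix x
    have "poly p x + poly p (1 - x) = 1" "poly q x + poly q (1 - x) = 1"
      using p q unfolding node_poly_def by blast+
    then show "poly (p - q) (1 - x) = - poly (p - q) x"
      by (simp add: algebra_simps)
  next
    have "inj_on a {1..l}"
      using a strict_mono_on_imp_inj_on by (auto simp: nodes_def)
    then have "card (a ` {1..l}) = l"
      by (simp add: card_image)
    moreover have "degree (p - q) \<le> 4 * l + 1"
      using p q by (intro degree_diff_le) (auto simp: node_poly_def)
    ultimately show "degree (p - q) \<le> 4 * card (a ` {1..l}) + 2"
      by simp
  next
    show "a ` {1..l} \<subseteq> {0<..<1/2}"
      by (rule nodes_subset[OF a])
  qed (use p q in \<open>auto simp: node_poly_def pderiv_diff\<close>)
  then show ?thesis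
    by simp
qed

section \<open>Chebyshev polynomials\<close>

fun cheb :: "nat \<Rightarrow> real poly" where
  "cheb 0 = 1"
| "cheb (Suc 0) = [:0, 1:]"
| "cheb (Suc (Suc n)) = [:0, 2:] * cheb (Suc n) - cheb n"

lemma poly_cheb_cos: "poly (cheb n) (cos t) = cos (real n * t)"
proof (induction n rule: cheb.induct)
  case (3 n)
  have "cos (real (Suc (Suc n)) * t) + cos (real n * t) = 2 * cos t * cos (real (Suc n) * t)"
    using cos_add[of "real (Suc n) * t" t] cos_diff[of "real (Suc n) * t" t]
    by (simp add: algebra_simps)
  with 3 show ?case
    by (simp add: algebra_simps)
qed simp_all

lemma poly_cheb_minus: "poly (cheb n) (- x) = (-1) ^ n * poly (cheb n) x"
  by (induction n rule: cheb.induct) (simp_all add: algebra_simps)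

lemma degree_cheb: "degree (cheb n) = n"
proof (induction n rule: cheb.induct)
  case (3 n)
  have "cheb (Suc n) \<noteq> 0"
    using 3 by auto
  then have "degree ([:0, 2:] * cheb (Suc n)) = Suc (Suc n)"
    using 3 by (subst degree_mult_eq) auto
  moreover from this have "degree ([:0, 2:] * cheb (Suc n) + - cheb n) = degree ([:0, 2:] * cheb (Suc n))"
    using 3 by (intro degree_add_eq_left) simp
  ultimately show ?case
    by simp
qed simp_all

lemma abs_cheb_le_1:
  assumes "\<bar>x\<bar> \<le> 1"
  shows "\<bar>poly (cheb n) x\<bar> \<le> 1"
  using poly_cheb_cos[of n "arccos x"] cos_arccos_abs[OF assms] by simp

section \<open>The Chebyshev polynomial as an interpolating polynomial\<close>

definition cheb_node :: "nat \<Rightarrow> nat \<Rightarrow> real" where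
  "cheb_node l i = (1 - cos (2 * pi * real i / real (4 * l + 1))) / 2"

definition cheb_node_poly :: "nat \<Rightarrow> real poly" where
  "cheb_node_poly l = smult (1/2) (1 - pcompose (cheb (4 * l + 1)) [:1, -2:])"

lemma poly_cheb_node_poly:
  "poly (cheb_node_poly l) x = (1 - poly (cheb (4 * l + 1)) (1 - 2 * x)) / 2"
  by (simp add: cheb_node_poly_def poly_pcompose mult.commute del: cheb.simps)

lemma cheb_node_poly_bounds:
  assumes "0 \<le> x" "x \<le> 1"
  shows "0 \<le> poly (cheb_node_poly l) x" "poly (cheb_node_poly l) x \<le> 1"
proof -
  have "\<bar>poly (cheb (4 * l + 1)) (1 - 2 * x)\<bar> \<le> 1"
    using assms by (intro abs_cheb_le_1) auto
  then show "0 \<le> poly (cheb_node_poly l) x" "poly (cheb_node_poly l) x \<le> 1"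
    unfolding poly_cheb_node_poly by (simp_all add: abs_le_iff del: cheb.simps)
qed

lemma nodes_cheb_node:
  assumes "l \<ge> 1"
  shows "nodes l (cheb_node l)"
proof -
  define t where "t i = 2 * pi * real i / real (4 * l + 1)" for i
  have node: "cheb_node l i = (1 - cos (t i)) / 2" for i
    by (simp add: cheb_node_def t_def)
  have t_nonneg: "0 \<le> t i" for i
    by (simp add: t_def)
  have t_less: "t i < pi / 2" if "i \<le> l" for i
  proof -
    have "pi * (4 * real i) < pi * (4 * real l + 1)"
      using that by (intro mult_strict_left_mono) auto
    then show ?thesis
      by (simp add: t_def field_simps)
  qed
  have mono: "cheb_node l i < cheb_node l j" if "i < j" "j \<le> l" for i j
  proof -
    have "t i < t j"
      using that unfolding t_def by (intro divide_strict_right_mono) auto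
    then have "cos (t j) < cos (t i)"
      using t_nonneg[of i] t_less[OF that(2)] by (intro cos_monotone_0_pi) auto
    then show ?thesis
      by (simp add: node)
  qed
  have "cheb_node l 0 = 0"
    by (simp add: cheb_node_def)
  then have "0 < cheb_node l 1"
    using mono[of 0 1] assms by simp
  moreover have "cheb_node l l < 1 / 2"
    using cos_gt_zero_pi[of "t l"] t_nonneg[of l] t_less[of l] by (simp add: node)
  ultimately show ?thesis
    using mono by (auto simp: nodes_def strict_mono_on_def)
qed

lemma poly_cheb_node_poly_node: "poly (cheb_node_poly l) (cheb_node l i) = 0"
proof -
  have "poly (cheb (4 * l + 1)) (1 - 2 * cheb_node l i)
      = cos (real (4 * l + 1) * (2 * pi * real i / real (4 * l + 1)))"
    unfolding poly_cheb_cos[symmetric] by (simp add: cheb_node_def diff_divide_distrib)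
  also have "\<dots> = cos (2 * pi * real i)"
    by (simp del: of_nat_add of_nat_mult)
  also have "\<dots> = 1"
    using cos_2npi[of i] by (simp add: mult_ac)
  finally show ?thesis
    by (simp add: poly_cheb_node_poly)
qed

lemma node_poly_cheb_node_poly:
  assumes "l \<ge> 1"
  shows "node_poly l (cheb_node l) (cheb_node_poly l)"
  unfolding node_poly_def
proof (intro conjI allI ballI)
  have "degree (pcompose (cheb (4 * l + 1)) [:1, -2:]) = 4 * l + 1"
    by (simp add: degree_pcompose degree_cheb del: cheb.simps)
  then have "degree (1 + - pcompose (cheb (4 * l + 1)) [:1, -2:]) = 4 * l + 1"
    by (subst degree_add_eq_right) auto
  then show "degree (cheb_node_poly l) = 4 * l + 1"
    by (simp add: cheb_node_poly_def)
next
  fix x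
  have "poly (cheb (4 * l + 1)) (1 - 2 * (1 - x)) = - poly (cheb (4 * l + 1)) (1 - 2 * x)"
    using poly_cheb_minus[of "4 * l + 1" "1 - 2 * x"] by (simp del: cheb.simps)
  then show "poly (cheb_node_poly l) x + poly (cheb_node_poly l) (1 - x) = 1"
    by (simp add: poly_cheb_node_poly field_simps del: cheb.simps)
next
  have "cheb_node l 0 = 0"
    by (simp add: cheb_node_def)
  then show "poly (cheb_node_poly l) 0 = 0"
    using poly_cheb_node_poly_node[of l 0] by simp
next
  fix i assume i: "i \<in> {1..l}"
  show "poly (cheb_node_poly l) (cheb_node l i) = 0"
    by (rule poly_cheb_node_poly_node)
  define c where "c = cheb_node l i"
  have c: "0 < c" "c < 1/2"
    using nodes_subset[OF nodes_cheb_node[OF assms]] i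
    unfolding c_def by (meson greaterThanLessThan_iff image_subset_iff)+
  \<comment> \<open>The node is a minimum of the polynomial on the interval of radius \<open>c\<close> about it, which
    lies inside \<open>[0, 1]\<close>.\<close>
  have "poly (pderiv (cheb_node_poly l)) c = 0"
  proof (rule DERIV_local_min[OF poly_DERIV c(1)], intro allI impI)
    fix y assume "\<bar>c - y\<bar> < c"
    then have "0 \<le> poly (cheb_node_poly l) y"
      using c by (intro cheb_node_poly_bounds) auto
    then show "poly (cheb_node_poly l) c \<le> poly (cheb_node_poly l) y"
      by (simp add: c_def poly_cheb_node_poly_node)
  qed
  then show "poly (pderiv (cheb_node_poly l)) (cheb_node l i) = 0"
    by (simp add: c_def)
qed

theorem lemma3p4:
  fixes l :: nat
  assumes "l \<ge> 1"
  shows "\<exists>a :: nat \<Rightarrow> real. nodes l a \<and>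
           (\<exists>!p. node_poly l a p) \<and>
           (\<forall>p. node_poly l a p \<longrightarrow> (\<forall>x\<in>{0..1/2}. poly p x \<le> 1))"
proof (intro exI conjI)
  let ?a = "cheb_node l" and ?p = "cheb_node_poly l"
  show a: "nodes l ?a"
    by (rule nodes_cheb_node[OF assms])
  have p: "node_poly l ?a ?p"
    by (rule node_poly_cheb_node_poly[OF assms])
  show "\<exists>!p. node_poly l ?a p"
    using p node_poly_unique[OF a] by blast
  show "\<forall>p. node_poly l ?a p \<longrightarrow> (\<forall>x\<in>{0..1/2}. poly p x \<le> 1)"
  proof (intro allI impI ballI)
    fix p and x :: real assume "node_poly l ?a p" and x: "x \<in> {0..1/2}"
    then have "p = ?p"
      using p node_poly_unique[OF a] by blast
    then show "poly p x \<le> 1"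
      using cheb_node_poly_bounds(2)[of x l] x by simp
  qed
qed

end
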